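(* Let $\phi$ be a De Morgan formula over $x_1,\dots,x_n$ of size $s$ and depth $d$, and let $\mathbf{p}$ be a $q$-fixing random projection from $x_1,\dots,x_n$ to $y_1,\dots,y_m$. Then \[\mathbb{E}\left[L(\phi|_{\mathbf{p}})\right]=O\!\left(q^2\cdot d^2\cdot s+q\cdot\sqrt{s}\right),\] where the constant in the $O(\cdot)$ is absolute.
   Context: A De Morgan formula is a binary tree whose leaves are labeled by literals $x_i,\overline{x_i}$ and internal nodes by AND/OR; size is the number of leaves and depth the depth of the tree. $L(f)$ denotes the minimal size of a formula computing $f$ ($L$ of a constant function is $0$); for a formula $\phi$, $L(\phi)$ is $L$ of the function it computes. A projection $\pi$ from $x_1,\dots,x_n$ to $y_1,\dots,y_m$ is a map $\{x_1,\dots,x_n\}\to\{0,1,y_1,\overline{y_1},\dots,y_m,\overline{y_m}\}$; $f|_\pi$ is the function of $y_1,\dots,y_m$ obtained by substituting $\pi(x_i)$ for each $x_i$. A random projection is a distribution over projections. For a projection $\pi$, a variable $y_j$ and $\sigma\in\{0,1\}$, $\pi_{y_j\gets\sigma}$ is the projection obtained from $\pi$ by substituting $y_j$ with $\sigma$; for a literal $\ell$, $\mathrm{var}(\ell)$ is its underlying variable. For $0\le q_0,q_1\le 1$, a random projection $\mathbf{p}$ is $(q_0,q_1)$-fixing if for every projection $\pi$, every $\sigma\in\{0,1\}$ and every variable $x_i$, \[\Pr[\mathbf{p}(x_i)\notin\{0,1\}\text{ and }\mathbf{p}_{\mathrm{var}(\mathbf{p}(x_i))\gets\sigma}=\pi]\le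 q_\sigma\cdot\Pr[\mathbf{p}=\pi].\] $\mathbf{p}$ is called $q$-fixing if it is $(q_0,q_1)$-fixing for some $q_0,q_1$ with $q=\sqrt{q_0q_1}$. *)

theory Defs
  imports "HOL-Probability.Probability"
begin

datatype literal = Pos nat | Neg nat

fun lit_var :: "literal \<Rightarrow> nat" where
  "lit_var (Pos j) = j"
| "lit_var (Neg j) = j"

fun lit_val :: "(nat \<Rightarrow> bool) \<Rightarrow> literal \<Rightarrow> bool" where
  "lit_val a (Pos j) \<longleftrightarrow> a j"
| "lit_val a (Neg j) \<longleftrightarrow> \<not> a j"

datatype formula = Leaf literal | And formula formula | Or formula formula

fun fvars :: "formula \<Rightarrow> nat set" where
  "fvars (Leaf l) = {lit_var l}"
| "fvars (And \<phi> \<psi>) = fvars \<phi> \<union> fvars \<psi>"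
| "fvars (Or \<phi> \<psi>) = fvars \<phi> \<union> fvars \<psi>"

fun fsize :: "formula \<Rightarrow> nat" where
  "fsize (Leaf l) = 1"
| "fsize (And \<phi> \<psi>) = fsize \<phi> + fsize \<psi>"
| "fsize (Or \<phi> \<psi>) = fsize \<phi> + fsize \<psi>"

fun fdepth :: "formula \<Rightarrow> nat" where
  "fdepth (Leaf l) = 0"
| "fdepth (And \<phi> \<psi>) = Suc (max (fdepth \<phi>) (fdepth \<psi>))"
| "fdepth (Or \<phi> \<psi>) = Suc (max (fdepth \<phi>) (fdepth \<psi>))"

fun feval :: "formula \<Rightarrow> (nat \<Rightarrow> bool) \<Rightarrow> bool" where
  "feval (Leaf l) a \<longleftrightarrow> lit_val a l"
| "feval (And \<phi> \<psi>) a \<longleftrightarrow> feval \<phi> a \<and> feval \<psi> a"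
| "feval (Or \<phi> \<psi>) a \<longleftrightarrow> feval \<phi> a \<or> feval \<psi> a"

definition formula_over :: "nat \<Rightarrow> formula \<Rightarrow> bool" where
  "formula_over n \<phi> \<longleftrightarrow> fvars \<phi> \<subseteq> {1..n}"

text \<open>A Boolean function of \<open>m\<close> variables is represented as a function on total assignments
  \<open>nat \<Rightarrow> bool\<close> whose value depends only on the variables \<open>1, \<dots>, m\<close>; the complexity below is
  meaningful only for such functions.\<close>

definition formula_complexity :: "nat \<Rightarrow> ((nat \<Rightarrow> bool) \<Rightarrow> bool) \<Rightarrow> nat" where
  "formula_complexity m f =
     (if \<exists>c. \<forall>a. f a = c then 0
      else LEAST s. \<exists>\<psi>. formula_over m \<psi> \<and> (\<forall>a. feval \<psi> a = f a) \<and> fsize \<psi> = s)"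

datatype pvalue = Const bool | Lit literal

fun pvalue_val :: "(nat \<Rightarrow> bool) \<Rightarrow> pvalue \<Rightarrow> bool" where
  "pvalue_val a (Const b) \<longleftrightarrow> b"
| "pvalue_val a (Lit l) \<longleftrightarrow> lit_val a l"

text \<open>Projections are extensional (\<open>undefined\<close> outside \<open>{1..n}\<close>), so that equality of functions is
  equality of projections.\<close>

definition projections :: "nat \<Rightarrow> nat \<Rightarrow> (nat \<Rightarrow> pvalue) set" where
  "projections n m = {1..n} \<rightarrow>\<^sub>E (range Const \<union> Lit ` {l. lit_var l \<in> {1..m}})"

definition apply_projection ::
  "((nat \<Rightarrow> bool) \<Rightarrow> bool) \<Rightarrow> (nat \<Rightarrow> pvalue) \<Rightarrow> ((nat \<Rightarrow> bool) \<Rightarrow> bool)" where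
  "apply_projection f \<pi> = (\<lambda>a. f (\<lambda>i. pvalue_val a (\<pi> i)))"

fun subst_pvalue :: "nat \<Rightarrow> bool \<Rightarrow> pvalue \<Rightarrow> pvalue" where
  "subst_pvalue j \<sigma> (Const b) = Const b"
| "subst_pvalue j \<sigma> (Lit (Pos k)) = (if k = j then Const \<sigma> else Lit (Pos k))"
| "subst_pvalue j \<sigma> (Lit (Neg k)) = (if k = j then Const (\<not> \<sigma>) else Lit (Neg k))"

definition subst_projection ::
  "nat \<Rightarrow> (nat \<Rightarrow> pvalue) \<Rightarrow> nat \<Rightarrow> bool \<Rightarrow> (nat \<Rightarrow> pvalue)" where
  "subst_projection n \<pi> j \<sigma> = (\<lambda>i\<in>{1..n}. subst_pvalue j \<sigma> (\<pi> i))"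

definition random_projection :: "nat \<Rightarrow> nat \<Rightarrow> (nat \<Rightarrow> pvalue) pmf \<Rightarrow> bool" where
  "random_projection n m p \<longleftrightarrow> set_pmf p \<subseteq> projections n m"

definition fixing2 ::
  "nat \<Rightarrow> nat \<Rightarrow> real \<Rightarrow> real \<Rightarrow> (nat \<Rightarrow> pvalue) pmf \<Rightarrow> bool" where
  "fixing2 n m q\<^sub>0 q\<^sub>1 p \<longleftrightarrow>
     0 \<le> q\<^sub>0 \<and> q\<^sub>0 \<le> 1 \<and> 0 \<le> q\<^sub>1 \<and> q\<^sub>1 \<le> 1 \<and>
     (\<forall>\<pi>\<in>projections n m. \<forall>\<sigma>. \<forall>i\<in>{1..n}.
        measure_pmf.prob p
          {\<rho>. \<exists>l. \<rho> i = Lit l \<and> subst_projection n \<rho> (lit_var l) \<sigma> = \<pi>}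
        \<le> (if \<sigma> then q\<^sub>1 else q\<^sub>0) * pmf p \<pi>)"

definition fixing :: "nat \<Rightarrow> nat \<Rightarrow> real \<Rightarrow> (nat \<Rightarrow> pvalue) pmf \<Rightarrow> bool" where
  "fixing n m q p \<longleftrightarrow> (\<exists>q\<^sub>0 q\<^sub>1. fixing2 n m q\<^sub>0 q\<^sub>1 p \<and> q = sqrt (q\<^sub>0 * q\<^sub>1))"

end

theory Submission
  imports Defs
begin

text \<open>
  Write \<open>L\<^sub>2\<close> for formula complexity truncated to \<open>0\<close> on functions of complexity at most \<open>1\<close>, and let
  \<open>q = sqrt (q\<^sub>0 q\<^sub>1)\<close>.

  A Khrapchenko-style induction on the formula shows that \<open>\<phi>\<close> of size \<open>s\<close> becomes a literal under a
  \<open>(q\<^sub>0, q\<^sub>1)\<close>-fixing projection with probability at most \<open>q \<surd>s\<close>.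
  At a gate with inputs \<open>g\<close> and \<open>h\<close>, \<open>L\<^sub>2\<close> is additive up to an extra cost of \<open>1\<close> whenever \<open>g\<close> becomes a
  literal and \<open>h\<close> stays non-constant after this literal is set to the neutral value of the gate
  (and symmetrically).  The projection conditioned on \<open>g\<close> becoming a literal, followed by setting this
  literal, is again \<open>(q\<^sub>0, q\<^sub>1)\<close>-fixing.  Hence, if \<open>g\<close> and \<open>h\<close> have sizes \<open>s\<close> and \<open>t\<close> and depth at most
  \<open>D\<close>, by induction the extra cost is at most
  \<open>q \<surd>s \<cdot> min 1 (q \<surd>t + q\<^sup>2 D\<^sup>2 t) \<le> q\<^sup>2 (1 + D) \<surd>(s t)\<close>, which sums to \<open>E[L\<^sub>2] \<le> q\<^sup>2 d\<^sup>2 s\<close>.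
\<close>

section \<open>Truncated formula complexity\<close>

definition is_const :: "((nat \<Rightarrow> bool) \<Rightarrow> bool) \<Rightarrow> bool" where
  "is_const f \<longleftrightarrow> (\<exists>c. \<forall>a. f a = c)"

definition literal_fn :: "nat \<Rightarrow> bool \<Rightarrow> ((nat \<Rightarrow> bool) \<Rightarrow> bool) \<Rightarrow> bool" where
  "literal_fn j \<tau> f \<longleftrightarrow> (\<forall>a. f a = (a j = \<tau>))"

definition is_literal :: "((nat \<Rightarrow> bool) \<Rightarrow> bool) \<Rightarrow> bool" where
  "is_literal f \<longleftrightarrow> (\<exists>j \<tau>. literal_fn j \<tau> f)"

text \<open>The description is meaningful only for literal functions, where
  \<open>literal_fn_unique\<close> makes it well defined; the same holds for
  \<open>literal_sign\<close>.\<close>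

definition literal_var :: "((nat \<Rightarrow> bool) \<Rightarrow> bool) \<Rightarrow> nat" where
  "literal_var f = (THE j. \<exists>\<tau>. literal_fn j \<tau> f)"

definition literal_sign :: "((nat \<Rightarrow> bool) \<Rightarrow> bool) \<Rightarrow> bool" where
  "literal_sign f = (THE \<tau>. \<exists>j. literal_fn j \<tau> f)"

definition computable :: "nat \<Rightarrow> ((nat \<Rightarrow> bool) \<Rightarrow> bool) \<Rightarrow> bool" where
  "computable m f \<longleftrightarrow> (\<exists>\<psi>. formula_over m \<psi> \<and> (\<forall>a. feval \<psi> a = f a))"

text \<open>Literals have probability of order q, too much to be paid at every leaf. Truncation
  makes leaves free, so that only costs of order q squared are summed over the gates; literals are
  counted once, for the whole formula.\<close>

definition complexity2 :: "nat \<Rightarrow> ((nat \<Rightarrow> bool) \<Rightarrow> bool) \<Rightarrow> nat" where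
  "complexity2 m f = (if formula_complexity m f \<le> 1 then 0 else formula_complexity m f)"

lemma literal_fn_unique:
  assumes "literal_fn j \<tau> f" "literal_fn k \<upsilon> f"
  shows "j = k \<and> \<tau> = \<upsilon>"
proof -
  have eq: "(a j = \<tau>) = (a k = \<upsilon>)" for a
    using assms by (auto simp: literal_fn_def)
  show ?thesis
    \<comment> \<open>The all-true assignment forces equal signs; switching off \<open>j\<close>
      alone then separates distinct variables.\<close>
    using eq[of "\<lambda>_. True"] eq[of "(\<lambda>_. True)(j := False)"]
    by (cases "j = k"; cases \<tau>; cases \<upsilon>) simp_all
qed

lemma literal_var_sign:
  assumes "literal_fn j \<tau> f"
  shows "literal_var f = j" "literal_sign f = \<tau>"
proof -
  show "literal_var f = j"
    unfolding literal_var_def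
    by (rule the_equality) (use assms literal_fn_unique in blast)+
  show "literal_sign f = \<tau>"
    unfolding literal_sign_def
    by (rule the_equality) (use assms literal_fn_unique in blast)+
qed

lemma literal_fn_not_const:
  assumes "literal_fn j \<tau> f"
  shows "\<not> is_const f"
proof
  assume "is_const f"
  then obtain c where "\<And>a. (a j = \<tau>) = c"
    using assms by (auto simp: is_const_def literal_fn_def)
  from this[of "\<lambda>_. \<tau>"] this[of "\<lambda>_. \<not> \<tau>"] show False by auto
qed

lemma fsize_pos: "0 < fsize \<phi>"
  by (induction \<phi>) auto

lemma formula_complexity_const: "is_const f \<Longrightarrow> formula_complexity m f = 0"
  unfolding formula_complexity_def is_const_def by (rule if_P)

lemma formula_complexity_not_const:
  "\<not> is_const f \<Longrightarrow> formula_complexity m f =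
    (LEAST s. \<exists>\<psi>. formula_over m \<psi> \<and> (\<forall>a. feval \<psi> a = f a) \<and> fsize \<psi> = s)"
  unfolding formula_complexity_def is_const_def by (rule if_not_P)

lemma formula_complexity_le:
  assumes "formula_over m \<psi>" "\<And>a. feval \<psi> a = f a"
  shows "formula_complexity m f \<le> fsize \<psi>"
proof (cases "is_const f")
  case False
  show ?thesis
    unfolding formula_complexity_not_const[OF False] by (rule Least_le) (use assms in blast)
qed (simp add: formula_complexity_const)

lemma formula_complexity_witness:
  assumes "computable m f" "\<not> is_const f"
  obtains \<psi> where "formula_over m \<psi>" "\<And>a. feval \<psi> a = f a" "fsize \<psi> = formula_complexity m f"
proof -
  have "\<exists>s \<psi>. formula_over m \<psi> \<and> (\<forall>a. feval \<psi> a = f a) \<and> fsize \<psi> = s"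
    using assms(1) unfolding computable_def by blast
  from LeastI_ex[OF this] show ?thesis
    using that unfolding formula_complexity_not_const[OF assms(2)] by blast
qed

text \<open>Every formula reads some variable, so for \<open>m = 0\<close> no formula exists, not
  even for a constant. Hence the disjunction of constant and computable, which recurs below: it
  ensures that \<open>LEAST\<close> is taken over a nonempty set whenever it is used.\<close>

lemma formula_complexity_eq_0_iff:
  assumes "is_const f \<or> computable m f"
  shows "formula_complexity m f = 0 \<longleftrightarrow> is_const f"
  using assms formula_complexity_const formula_complexity_witness fsize_pos
  by (metis less_irrefl)

lemma fsize_1E:
  assumes "fsize \<psi> = 1"
  obtains l where "\<psi> = Leaf l"
proof (cases \<psi>)
  case (And x y)
  then show ?thesis using assms fsize_pos[of x] fsize_pos[of y] by simp
next
  case (Or x y)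
  then show ?thesis using assms fsize_pos[of x] fsize_pos[of y] by simp
qed (use that in auto)

lemma formula_complexity_1_literal:
  assumes "is_const f \<or> computable m f" "formula_complexity m f = 1"
  shows "is_literal f"
proof -
  have "\<not> is_const f" using assms(2) formula_complexity_const by fastforce
  then obtain \<psi> where \<psi>: "\<And>a. feval \<psi> a = f a" "fsize \<psi> = 1"
    using assms formula_complexity_witness by metis
  obtain l where "\<psi> = Leaf l" using \<psi>(2) by (rule fsize_1E)
  then have "f a = lit_val a l" for a using \<psi>(1)[of a] by simp
  then have "literal_fn (lit_var l) (case l of Pos _ \<Rightarrow> True | Neg _ \<Rightarrow> False) f"
    by (cases l) (simp_all add: literal_fn_def)
  then show ?thesis by (auto simp: is_literal_def)
qed

section \<open>Gates\<close>

text \<open>A gate is named by its neutral value: \<open>gate True\<close> is conjunction, \<open>gate False\<close> disjunction.\<close>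

definition gate :: "bool \<Rightarrow> bool \<Rightarrow> bool \<Rightarrow> bool" where
  "gate b x y = (if b then x \<and> y else x \<or> y)"

text \<open>A constant input is either neutral, and the gate passes on the other input, or
  absorbing, and the gate is constant.\<close>

lemma gate_const_cases:
  assumes "is_const G"
  shows "is_const (\<lambda>a. gate b (G a) (H a)) \<or> (\<lambda>a. gate b (G a) (H a)) = H"
proof -
  obtain c where "\<And>a. G a = c" using assms by (auto simp: is_const_def)
  then show ?thesis by (cases "c = b") (auto simp: is_const_def gate_def)
qed

lemma gate_commute: "gate b x y = gate b y x"
  by (auto simp: gate_def)

definition gate_formula :: "bool \<Rightarrow> formula \<Rightarrow> formula \<Rightarrow> formula" where
  "gate_formula b \<phi> \<psi> = (if b then And \<phi> \<psi> else Or \<phi> \<psi>)"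

lemma feval_gate_formula: "feval (gate_formula b \<phi> \<psi>) a = gate b (feval \<phi> a) (feval \<psi> a)"
  by (simp add: gate_formula_def gate_def)

lemma gate_formula_simps [simp]:
  "fsize (gate_formula b \<phi> \<psi>) = fsize \<phi> + fsize \<psi>"
  "fdepth (gate_formula b \<phi> \<psi>) = Suc (max (fdepth \<phi>) (fdepth \<psi>))"
  "formula_over n (gate_formula b \<phi> \<psi>) \<longleftrightarrow> formula_over n \<phi> \<and> formula_over n \<psi>"
  by (auto simp: gate_formula_def formula_over_def)

text \<open>Conjunction and disjunction become one case, so dual arguments need not be given
  twice.\<close>

lemma formula_gate_induct [case_names Leaf gate]:
  assumes "\<And>l. P (Leaf l)" "\<And>b \<phi> \<psi>. P \<phi> \<Longrightarrow> P \<psi> \<Longrightarrow> P (gate_formula b \<phi> \<psi>)"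
  shows "P \<phi>"
proof (induction \<phi>)
  case (And \<phi> \<psi>)
  then show ?case using assms(2)[of \<phi> \<psi> True] by (simp add: gate_formula_def)
next
  case (Or \<phi> \<psi>)
  then show ?case using assms(2)[of \<phi> \<psi> False] by (simp add: gate_formula_def)
qed (rule assms)

lemma const_or_computable_gate:
  assumes "is_const G \<or> computable m G" "is_const H \<or> computable m H"
  shows "is_const (\<lambda>a. gate b (G a) (H a)) \<or> computable m (\<lambda>a. gate b (G a) (H a))"
proof -
  consider "is_const G" | "is_const H" | "computable m G" "computable m H" using assms by blast
  then show ?thesis
  proof cases
    case 1
    then show ?thesis using gate_const_cases[OF 1, of b H] assms by auto
  next
    case 2
    then show ?thesis using gate_const_cases[OF 2, of b G] assms
      by (auto simp: gate_commute[of b "G _"])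
  next
    case 3
    then obtain \<phi> \<psi> where "formula_over m \<phi>" "formula_over m \<psi>"
      "\<forall>a. feval \<phi> a = G a" "\<forall>a. feval \<psi> a = H a"
      by (auto simp: computable_def)
    then have "computable m (\<lambda>a. gate b (G a) (H a))"
      unfolding computable_def by (intro exI[of _ "gate_formula b \<phi> \<psi>"]) (simp add: feval_gate_formula)
    then show ?thesis ..
  qed
qed

lemma formula_complexity_gate_le:
  assumes "is_const G \<or> computable m G" "is_const H \<or> computable m H"
  shows "formula_complexity m (\<lambda>a. gate b (G a) (H a))
    \<le> formula_complexity m G + formula_complexity m H"
proof -
  consider "is_const G" | "is_const H" | "\<not> is_const G" "\<not> is_const H" by blast
  then show ?thesis
  proof cases
    case 1
    then show ?thesis using gate_const_cases[OF 1, of b H]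
      by (auto simp: formula_complexity_const)
  next
    case 2
    then show ?thesis using gate_const_cases[OF 2, of b G]
      by (auto simp: formula_complexity_const gate_commute[of b "G _"])
  next
    case 3
    then obtain \<phi> \<psi> where "formula_over m \<phi>" "\<And>a. feval \<phi> a = G a" "fsize \<phi> = formula_complexity m G"
      "formula_over m \<psi>" "\<And>a. feval \<psi> a = H a" "fsize \<psi> = formula_complexity m H"
      using assms formula_complexity_witness by metis
    then show ?thesis
      using formula_complexity_le[of m "gate_formula b \<phi> \<psi>" "\<lambda>a. gate b (G a) (H a)"]
      by (simp add: feval_gate_formula)
  qed
qed

section \<open>The extra cost at a gate\<close>

text \<open>Giving the variable of the literal \<open>G\<close> the value
  \<open>literal_sign G = b\<close> makes \<open>G\<close> equal to the neutral value
  \<open>b\<close>, and the gate then passes on \<open>H\<close>.\<close>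

definition survives :: "bool \<Rightarrow> ((nat \<Rightarrow> bool) \<Rightarrow> bool) \<Rightarrow> ((nat \<Rightarrow> bool) \<Rightarrow> bool) \<Rightarrow> bool" where
  "survives b G H \<longleftrightarrow> is_literal G \<and>
     \<not> is_const (\<lambda>a. H (a(literal_var G := (literal_sign G = b))))"

lemma survives_literal_fn_iff:
  assumes "literal_fn j \<tau> G"
  shows "survives b G H \<longleftrightarrow> \<not> is_const (\<lambda>a. H (a(j := (\<tau> = b))))"
  using assms literal_var_sign[OF assms] by (auto simp: survives_def is_literal_def)

lemma gate_not_survives:
  assumes G: "is_literal G" and "\<not> survives b G H"
  shows "is_const (\<lambda>a. gate b (G a) (H a)) \<or> (\<lambda>a. gate b (G a) (H a)) = G"
proof -
  obtain j \<tau> where lit: "literal_fn j \<tau> G" using G by (auto simp: is_literal_def)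
  then obtain c where c: "\<And>a. H (a(j := (\<tau> = b))) = c"
    using assms(2) by (auto simp: survives_literal_fn_iff is_const_def)
  have Hc: "H a = c" if "G a = b" for a
  proof -
    have "a(j := (\<tau> = b)) = a" using that lit by (auto simp: literal_fn_def fun_eq_iff)
    then show ?thesis using c[of a] by simp
  qed
  \<comment> \<open>Where \<open>G\<close> is not neutral, it decides the gate; where it is neutral,
    the gate equals \<open>H\<close>, which is \<open>c\<close> there.\<close>
  have "gate b (G a) (H a) = (if c = b then G a else \<not> b)" for a
    using Hc[of a] by (cases "G a = b") (auto simp: gate_def)
  then show ?thesis by (cases "c = b") (auto simp: is_const_def fun_eq_iff)
qed

text \<open>Complexity is subadditive over gates, so truncation can break additivity only through
  inputs of complexity exactly 1. Such an input is a literal, and the unit it lost is needed only if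
  the other input survives it.\<close>

lemma complexity2_gate_le:
  assumes G: "is_const G \<or> computable m G" and H: "is_const H \<or> computable m H"
  shows "complexity2 m (\<lambda>a. gate b (G a) (H a))
    \<le> complexity2 m G + complexity2 m H + of_bool (survives b G H) + of_bool (survives b H G)"
    (is "complexity2 m ?F \<le> _")
proof -
  let ?L = "formula_complexity m"
  have sub: "?L ?F \<le> ?L G + ?L H" using formula_complexity_gate_le[OF G H] .
  have comm: "(\<lambda>a. gate b (H a) (G a)) = ?F" by (simp add: gate_commute)
  \<comment> \<open>Two literals, one surviving the other, have different variables, so survival is
    mutual. This yields both units when two inputs of complexity 1 form a gate of complexity
    2.\<close>
  have lits: "survives b H G" if lG: "is_literal G" and lH: "is_literal H" and s: "survives b G H"
  proof -
    obtain j \<tau> k \<upsilon> where l: "literal_fn j \<tau> G" "literal_fn k \<upsilon> H"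
      using lG lH by (auto simp: is_literal_def)
    have "\<not> is_const (\<lambda>a. H (a(j := (\<tau> = b))))"
      using s survives_literal_fn_iff[OF l(1)] by blast
    moreover have "H (a(j := (\<tau> = b))) = ((\<tau> = b) = \<upsilon>)" if "j = k" for a
      using l(2) that by (simp add: literal_fn_def)
    ultimately have "j \<noteq> k" unfolding is_const_def by blast
    then have "literal_fn j \<tau> (\<lambda>a. G (a(k := (\<upsilon> = b))))"
      using l by (auto simp: literal_fn_def)
    then show ?thesis using literal_fn_not_const survives_literal_fn_iff[OF l(2)] by blast
  qed
  \<comment> \<open>Without survival the gate is constant or equal to the literal, so its truncated
    complexity vanishes.\<close>
  have small: "?L ?F \<le> 1" if "?L G = 1" "\<not> survives b G H"
    using gate_not_survives[OF formula_complexity_1_literal[OF G that(1)] that(2)] that(1)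
    by (auto simp: formula_complexity_const)
  have small': "?L ?F \<le> 1" if "?L H = 1" "\<not> survives b H G"
    using gate_not_survives[OF formula_complexity_1_literal[OF H that(1)] that(2)] that(1)
    by (auto simp: formula_complexity_const comm)
  consider "?L G = 0" | "?L H = 0" | "?L G \<ge> 2" "?L H \<ge> 2" | "?L G = 1" "?L H \<ge> 2"
    | "?L G \<ge> 2" "?L H = 1" | "?L G = 1" "?L H = 1"
    by linarith
  then show ?thesis
  proof cases
    case 6
    then show ?thesis
      using sub small lits formula_complexity_1_literal[OF G] formula_complexity_1_literal[OF H]
      by (auto simp: complexity2_def)
  next
    case 3
    then show ?thesis using sub by (simp add: complexity2_def)
  next
    case 4
    then show ?thesis using sub small by (cases "survives b G H") (simp_all add: complexity2_def)
  next
    case 5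
    then show ?thesis using sub small' by (cases "survives b H G") (simp_all add: complexity2_def)
  next
    case 1
    then show ?thesis using sub by (simp add: complexity2_def)
  next
    case 2
    then show ?thesis using sub by (simp add: complexity2_def)
  qed
qed

section \<open>Projections\<close>

abbreviation restr :: "formula \<Rightarrow> (nat \<Rightarrow> pvalue) \<Rightarrow> (nat \<Rightarrow> bool) \<Rightarrow> bool" where
  "restr \<phi> \<equiv> apply_projection (feval \<phi>)"

lemma restr_gate: "restr (gate_formula b \<phi> \<psi>) \<pi> = (\<lambda>a. gate b (restr \<phi> \<pi> a) (restr \<psi> \<pi> a))"
  by (simp add: apply_projection_def feval_gate_formula)

lemma pvalue_val_subst: "pvalue_val a (subst_pvalue j \<sigma> v) = pvalue_val (a(j := \<sigma>)) v"
proof (cases v)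
  case (Lit l)
  then show ?thesis by (cases l) auto
qed simp

lemma subst_pvalue_eq_Lit:
  "subst_pvalue j \<sigma> v = Lit l \<longleftrightarrow> v = Lit l \<and> lit_var l \<noteq> j"
proof (cases v)
  case (Lit k)
  then show ?thesis by (cases k) auto
qed simp

lemma subst_pvalue_commute:
  "j \<noteq> k \<Longrightarrow> subst_pvalue j \<sigma> (subst_pvalue k \<tau> v) = subst_pvalue k \<tau> (subst_pvalue j \<sigma> v)"
proof (cases v)
  case (Lit l)
  then show "j \<noteq> k \<Longrightarrow> ?thesis" by (cases l) auto
qed simp

lemma subst_projection_commute:
  "j \<noteq> k \<Longrightarrow> subst_projection n (subst_projection n \<pi> k \<tau>) j \<sigma>
    = subst_projection n (subst_projection n \<pi> j \<sigma>) k \<tau>"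
  by (auto simp: subst_projection_def subst_pvalue_commute fun_eq_iff)

lemma subst_projection_in_projections:
  assumes "\<pi> \<in> projections n m"
  shows "subst_projection n \<pi> j \<sigma> \<in> projections n m"
  unfolding projections_def
proof (rule PiE_I)
  fix i assume i: "i \<in> {1..n}"
  then have "\<pi> i \<in> range Const \<union> Lit ` {l. lit_var l \<in> {1..m}}"
    using assms by (auto simp: projections_def)
  moreover have "subst_pvalue j \<sigma> v \<in> range Const \<or> subst_pvalue j \<sigma> v = v" for v
    by (cases "(j, \<sigma>, v)" rule: subst_pvalue.cases) auto
  ultimately show "subst_projection n \<pi> j \<sigma> i \<in> range Const \<union> Lit ` {l. lit_var l \<in> {1..m}}"
    using i by (fastforce simp: subst_projection_def)
qed (auto simp: subst_projection_def)

lemma feval_cong: "(\<And>i. i \<in> fvars \<phi> \<Longrightarrow> a i = b i) \<Longrightarrow> feval \<phi> a = feval \<phi> b"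
proof (induction \<phi>)
  case (Leaf l)
  then show ?case by (cases l) auto
qed auto

lemma restr_subst_projection:
  assumes "formula_over n \<phi>"
  shows "restr \<phi> (subst_projection n \<pi> j \<sigma>) a = restr \<phi> \<pi> (a(j := \<sigma>))"
  unfolding apply_projection_def
  using assms
  by (intro feval_cong) (auto simp: subst_projection_def pvalue_val_subst formula_over_def)

lemma finite_projections: "finite (projections n m)"
proof -
  have "{l. lit_var l \<in> {1..m}} \<subseteq> Pos ` {1..m} \<union> Neg ` {1..m}"
  proof
    fix l assume "l \<in> {l. lit_var l \<in> {1..m}}"
    then show "l \<in> Pos ` {1..m} \<union> Neg ` {1..m}" by (cases l) auto
  qed
  then have "finite {l. lit_var l \<in> {1..m}}" by (rule finite_subset) auto
  then show ?thesis unfolding projections_def by (intro finite_PiE) auto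
qed

lemma restr_leaf:
  assumes "\<pi> \<in> projections n m" "formula_over n (Leaf l)"
  shows "is_const (restr (Leaf l) \<pi>) \<or>
    (\<exists>k. formula_over m (Leaf k) \<and> (\<forall>a. feval (Leaf k) a = restr (Leaf l) \<pi> a))"
proof (cases "\<pi> (lit_var l)")
  case (Const c)
  then show ?thesis by (cases l) (auto simp: is_const_def apply_projection_def)
next
  case (Lit k)
  moreover have "\<pi> (lit_var l) \<in> range Const \<union> Lit ` {l. lit_var l \<in> {1..m}}"
    using assms by (auto simp: projections_def formula_over_def)
  ultimately have "formula_over m (Leaf k')" if "lit_var k' = lit_var k" for k'
    using that by (auto simp: formula_over_def)
  moreover have "\<exists>k'. lit_var k' = lit_var k \<and> (\<forall>a. lit_val a k' = restr (Leaf l) \<pi> a)"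
  proof (cases l)
    case (Pos i)
    then show ?thesis using Lit by (intro exI[of _ k]) (simp add: apply_projection_def)
  next
    case (Neg i)
    then show ?thesis using Lit
      by (intro exI[of _ "case k of Pos j \<Rightarrow> Neg j | Neg j \<Rightarrow> Pos j"])
        (simp add: apply_projection_def split: literal.split)
  qed
  ultimately show ?thesis by auto
qed

text \<open>Provides the side condition of the complexity lemmas for every restricted
  formula.\<close>

lemma restr_const_or_computable:
  assumes "\<pi> \<in> projections n m" "formula_over n \<phi>"
  shows "is_const (restr \<phi> \<pi>) \<or> computable m (restr \<phi> \<pi>)"
  using assms(2)
proof (induction \<phi> rule: formula_gate_induct)
  case (Leaf l)
  then show ?case using restr_leaf[OF assms(1)] unfolding computable_def by blast
next
  case (gate b \<phi> \<psi>)
  then show ?case by (simp add: restr_gate const_or_computable_gate)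
qed

section \<open>Fixing random projections\<close>

text \<open>The definition bounds the probability of reaching a single projection; a union bound
  over the finitely many projections in \<open>S\<close> extends it to sets.\<close>

lemma fixing2_set:
  assumes p: "random_projection n m p" and fix2: "fixing2 n m q\<^sub>0 q\<^sub>1 p" and i: "i \<in> {1..n}"
  shows "measure_pmf.prob p {\<rho>. \<exists>l. \<rho> i = Lit l \<and> subst_projection n \<rho> (lit_var l) \<sigma> \<in> S}
    \<le> (if \<sigma> then q\<^sub>1 else q\<^sub>0) * measure_pmf.prob p S"
proof -
  define E where "E \<pi> = {\<rho>. \<exists>l. \<rho> i = Lit l \<and> subst_projection n \<rho> (lit_var l) \<sigma> = \<pi>}" for \<pi>
  let ?S = "S \<inter> projections n m"
  let ?q = "if \<sigma> then q\<^sub>1 else q\<^sub>0"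
  have fin: "finite ?S" using finite_projections by blast
  have sp: "set_pmf p \<subseteq> projections n m" using p by (simp add: random_projection_def)
  have "measure_pmf.prob p {\<rho>. \<exists>l. \<rho> i = Lit l \<and> subst_projection n \<rho> (lit_var l) \<sigma> \<in> S}
      \<le> measure_pmf.prob p (\<Union>\<pi>\<in>?S. E \<pi>)"
    using sp subst_projection_in_projections
    by (intro measure_pmf.finite_measure_mono_AE)
      (auto simp: AE_measure_pmf_iff E_def)
  also have "\<dots> \<le> (\<Sum>\<pi>\<in>?S. measure_pmf.prob p (E \<pi>))"
    using fin by (intro measure_pmf.finite_measure_subadditive_finite) auto
  also have "\<dots> \<le> (\<Sum>\<pi>\<in>?S. ?q * pmf p \<pi>)"
    using fix2 i by (intro sum_mono) (auto simp: fixing2_def E_def)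
  also have "\<dots> = ?q * measure_pmf.prob p ?S"
    using fin by (simp add: measure_measure_pmf_finite sum_distrib_left)
  also have "\<dots> \<le> ?q * measure_pmf.prob p S"
    using fix2 by (intro mult_left_mono measure_pmf.finite_measure_mono) (auto simp: fixing2_def)
  finally show ?thesis .
qed

section \<open>The probability of becoming a literal\<close>

lemma cauchy_schwarz_two:
  fixes s t x y :: real
  assumes "0 \<le> s" "0 \<le> t" "0 \<le> x" "0 \<le> y"
  shows "sqrt (s * x) + sqrt (t * y) \<le> sqrt ((s + t) * (x + y))"
proof (rule real_le_rsqrt)
  \<comment> \<open>After squaring, the cross term is bounded by the inequality of arithmetic and
    geometric means for \<open>s * y\<close> and \<open>t * x\<close>.\<close>
  have "2 * (sqrt (s * y) * sqrt (t * x)) \<le> s * y + t * x"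
    using sum_squares_bound[of "sqrt (s * y)" "sqrt (t * x)"] assms by simp
  then have "2 * (sqrt (s * x) * sqrt (t * y)) \<le> s * y + t * x"
    by (simp add: real_sqrt_mult mult_ac)
  then show "(sqrt (s * x) + sqrt (t * y))\<^sup>2 \<le> (s + t) * (x + y)"
    using assms by (simp add: power2_sum algebra_simps)
qed

text \<open>The counterpart of Khrapchenko's edges between two sets of inputs: fixing one variable
  leads to \<open>A\<close> or to \<open>B\<close>, depending on the value. The value leading to
  \<open>A\<close> is recorded in \<open>b\<close> because \<open>q\<^sub>0\<close> and
  \<open>q\<^sub>1\<close> may differ.\<close>

definition edges :: "nat \<Rightarrow> bool \<Rightarrow> (nat \<Rightarrow> pvalue) set \<Rightarrow> (nat \<Rightarrow> pvalue) set \<Rightarrow> (nat \<Rightarrow> pvalue) set" where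
  "edges n b A B = {\<rho>. \<exists>j. subst_projection n \<rho> j b \<in> A \<and> subst_projection n \<rho> j (\<not> b) \<in> B}"

lemma edges_subset_leaf:
  assumes i: "i \<in> {1..n}"
    and diff: "\<And>\<pi> \<pi>'. \<pi> \<in> A \<Longrightarrow> \<pi>' \<in> B \<Longrightarrow> \<pi> i \<noteq> \<pi>' i"
  shows "edges n b A B \<subseteq> {\<rho>. \<exists>l. \<rho> i = Lit l \<and> subst_projection n \<rho> (lit_var l) b \<in> A}"
    and "edges n b A B \<subseteq> {\<rho>. \<exists>l. \<rho> i = Lit l \<and> subst_projection n \<rho> (lit_var l) (\<not> b) \<in> B}"
proof -
  have "\<exists>l. \<rho> i = Lit l \<and> lit_var l = j"
    if "subst_projection n \<rho> j b \<in> A" "subst_projection n \<rho> j (\<not> b) \<in> B" for \<rho> j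
  proof -
    \<comment> \<open>The two substitutions can differ at coordinate \<open>i\<close> only if
      \<open>\<rho> i\<close> is a literal of the variable \<open>j\<close>.\<close>
    have "subst_pvalue j b (\<rho> i) \<noteq> subst_pvalue j (\<not> b) (\<rho> i)"
      using diff[OF that] i by (simp add: subst_projection_def)
    then show ?thesis by (cases "(j, b, \<rho> i)" rule: subst_pvalue.cases) (auto split: if_splits)
  qed
  then show "edges n b A B \<subseteq> {\<rho>. \<exists>l. \<rho> i = Lit l \<and> subst_projection n \<rho> (lit_var l) b \<in> A}"
    "edges n b A B \<subseteq> {\<rho>. \<exists>l. \<rho> i = Lit l \<and> subst_projection n \<rho> (lit_var l) (\<not> b) \<in> B}"
    unfolding edges_def by blast+
qed

text \<open>Evaluating every projection at one fixed assignment \<open>a\<close> of the \<open>y\<close>-variables lets the induction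
  split \<open>A\<close> or \<open>B\<close> according to the value of a subformula; splitting by whether a subformula becomes
  constant would not work, since \<open>g \<and> h\<close> can be constant with neither \<open>g\<close> nor \<open>h\<close> constant.\<close>

lemma khrapchenko_edges:
  assumes p: "random_projection n m p" and fix2: "fixing2 n m q\<^sub>0 q\<^sub>1 p"
    and "formula_over n \<phi>"
    and "\<And>\<pi>. \<pi> \<in> A \<Longrightarrow> restr \<phi> \<pi> a = c" "\<And>\<pi>. \<pi> \<in> B \<Longrightarrow> restr \<phi> \<pi> a = (\<not> c)"
  shows "measure_pmf.prob p (edges n b A B)
    \<le> sqrt (q\<^sub>0 * q\<^sub>1) * sqrt (fsize \<phi> * (measure_pmf.prob p A * measure_pmf.prob p B))"
  using assms(3-)
proof (induction \<phi> arbitrary: A B b c rule: formula_gate_induct)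
  case (Leaf l)
  let ?P = "measure_pmf.prob p" and ?q = "\<lambda>\<sigma>. if \<sigma> then q\<^sub>1 else q\<^sub>0"
  let ?i = "lit_var l"
  have i: "?i \<in> {1..n}" using Leaf by (simp add: formula_over_def)
  have diff: "\<pi> ?i \<noteq> \<pi>' ?i" if "\<pi> \<in> A" "\<pi>' \<in> B" for \<pi> \<pi>'
    using Leaf.prems(2)[OF that(1)] Leaf.prems(3)[OF that(2)]
    by (cases l) (auto simp: apply_projection_def)
  have "?P (edges n b A B) \<le> ?P {\<rho>. \<exists>l. \<rho> ?i = Lit l \<and> subst_projection n \<rho> (lit_var l) b \<in> A}"
    by (intro measure_pmf.finite_measure_mono edges_subset_leaf(1) i diff) auto
  also have "\<dots> \<le> ?q b * ?P A" by (rule fixing2_set[OF p fix2 i])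
  finally have A: "?P (edges n b A B) \<le> ?q b * ?P A" .
  have "?P (edges n b A B)
      \<le> ?P {\<rho>. \<exists>l. \<rho> ?i = Lit l \<and> subst_projection n \<rho> (lit_var l) (\<not> b) \<in> B}"
    by (intro measure_pmf.finite_measure_mono edges_subset_leaf(2) i diff) auto
  also have "\<dots> \<le> ?q (\<not> b) * ?P B" by (rule fixing2_set[OF p fix2 i])
  finally have B: "?P (edges n b A B) \<le> ?q (\<not> b) * ?P B" .
  \<comment> \<open>One endpoint gives a bound with \<open>q\<^sub>0\<close>, the other with
    \<open>q\<^sub>1\<close>; their geometric mean brings in both.\<close>
  have "(?P (edges n b A B))\<^sup>2 \<le> (?q b * ?P A) * (?q (\<not> b) * ?P B)"
    unfolding power2_eq_square using A B fix2
    by (intro mult_mono) (auto simp: fixing2_def)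
  also have "\<dots> = (q\<^sub>0 * q\<^sub>1) * (?P A * ?P B)" by (cases b) auto
  finally show ?case by (simp add: real_le_rsqrt flip: real_sqrt_mult)
next
  case (gate b' \<phi> \<psi>)
  let ?P = "measure_pmf.prob p"
  define q where "q = sqrt (q\<^sub>0 * q\<^sub>1)"
  have q: "0 \<le> q" using fix2 by (simp add: q_def fixing2_def)
  have over: "formula_over n \<phi>" "formula_over n \<psi>" using gate.prems by auto
  have combine: "q * sqrt (fsize \<phi> * (x * z)) + q * sqrt (fsize \<psi> * (y * z))
      \<le> q * sqrt (real (fsize (gate_formula b' \<phi> \<psi>)) * ((x + y) * z))"
    if "0 \<le> x" "0 \<le> y" "0 \<le> z" for x y z :: real
    using cauchy_schwarz_two[of "fsize \<phi>" "fsize \<psi>" "x * z" "y * z"] that q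
    by (simp add: mult_left_mono flip: distrib_left distrib_right)
  show ?case
  proof (cases "c = b'")
    case True
    \<comment> \<open>On \<open>A\<close> the gate has its neutral value, which forces both inputs
      to be neutral. On \<open>B\<close> at least one input is not, so \<open>B\<close> is split by
      which one, and \<open>A\<close> is kept whole.\<close>
    define B1 where "B1 = {\<pi> \<in> B. restr \<phi> \<pi> a = (\<not> c)}"
    define B2 where "B2 = B - B1"
    have A: "restr \<phi> \<pi> a = c" "restr \<psi> \<pi> a = c" if "\<pi> \<in> A" for \<pi>
      using gate.prems(2)[OF that] True by (auto simp: restr_gate gate_def split: if_splits)
    have B: "restr \<psi> \<pi> a = (\<not> c)" if "\<pi> \<in> B2" for \<pi>
      using gate.prems(3)[of \<pi>] that True
      by (auto simp: restr_gate gate_def B1_def B2_def split: if_splits)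
    have PB: "?P B = ?P B1 + ?P B2"
      unfolding B2_def
      by (subst measure_pmf.finite_measure_Diff) (auto simp: B1_def)
    have "edges n b A B \<subseteq> edges n b A B1 \<union> edges n b A B2"
      by (auto simp: edges_def B2_def)
    then have "?P (edges n b A B) \<le> ?P (edges n b A B1 \<union> edges n b A B2)"
      by (intro measure_pmf.finite_measure_mono) auto
    also have "\<dots> \<le> ?P (edges n b A B1) + ?P (edges n b A B2)"
      by (intro measure_Un_le) auto
    also have "?P (edges n b A B1) \<le> q * sqrt (fsize \<phi> * (?P A * ?P B1))"
      unfolding q_def by (rule gate.IH(1)[OF over(1)]) (auto simp: A B1_def)
    also have "?P (edges n b A B2) \<le> q * sqrt (fsize \<psi> * (?P A * ?P B2))"
      unfolding q_def by (rule gate.IH(2)[OF over(2)]) (auto simp: A B)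
    finally show ?thesis
      using combine[of "?P B1" "?P B2" "?P A"] by (simp add: PB q_def mult_ac)
  next
    case False
    \<comment> \<open>Now the gate is neutral on \<open>B\<close>, so the roles are exchanged and
      \<open>A\<close> is split.\<close>
    define A1 where "A1 = {\<pi> \<in> A. restr \<phi> \<pi> a = c}"
    define A2 where "A2 = A - A1"
    have B: "restr \<phi> \<pi> a = (\<not> c)" "restr \<psi> \<pi> a = (\<not> c)" if "\<pi> \<in> B" for \<pi>
      using gate.prems(3)[OF that] False by (auto simp: restr_gate gate_def split: if_splits)
    have A: "restr \<psi> \<pi> a = c" if "\<pi> \<in> A2" for \<pi>
      using gate.prems(2)[of \<pi>] that False
      by (auto simp: restr_gate gate_def A1_def A2_def split: if_splits)
    have PA: "?P A = ?P A1 + ?P A2"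
      unfolding A2_def
      by (subst measure_pmf.finite_measure_Diff) (auto simp: A1_def)
    have "edges n b A B \<subseteq> edges n b A1 B \<union> edges n b A2 B"
      by (auto simp: edges_def A2_def)
    then have "?P (edges n b A B) \<le> ?P (edges n b A1 B \<union> edges n b A2 B)"
      by (intro measure_pmf.finite_measure_mono) auto
    also have "\<dots> \<le> ?P (edges n b A1 B) + ?P (edges n b A2 B)"
      by (intro measure_Un_le) auto
    also have "?P (edges n b A1 B) \<le> q * sqrt (fsize \<phi> * (?P A1 * ?P B))"
      unfolding q_def by (rule gate.IH(1)[OF over(1)]) (auto simp: B A1_def)
    also have "?P (edges n b A2 B) \<le> q * sqrt (fsize \<psi> * (?P A2 * ?P B))"
      unfolding q_def by (rule gate.IH(2)[OF over(2)]) (auto simp: A B)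
    finally show ?thesis
      using combine[of "?P A1" "?P A2" "?P B"] by (simp add: PA q_def mult_ac)
  qed
qed

text \<open>Fixing the variable of a literal makes it constant, true for one value and false for the
  other. So projections giving a literal are edges between those giving constant true and those
  giving constant false.\<close>

lemma prob_literal_le:
  assumes p: "random_projection n m p" and fix2: "fixing2 n m q\<^sub>0 q\<^sub>1 p"
    and over: "formula_over n \<phi>"
  shows "measure_pmf.prob p {\<pi>. is_literal (restr \<phi> \<pi>)} \<le> sqrt (q\<^sub>0 * q\<^sub>1) * sqrt (fsize \<phi>)"
proof -
  let ?P = "measure_pmf.prob p"
  define q where "q = sqrt (q\<^sub>0 * q\<^sub>1)"
  have q: "0 \<le> q" using fix2 by (simp add: q_def fixing2_def)
  define A where "A = {\<pi>. \<forall>a. restr \<phi> \<pi> a}"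
  define B where "B = {\<pi>. \<forall>a. \<not> restr \<phi> \<pi> a}"
  have "\<rho> \<in> edges n True A B \<union> edges n False A B" if lit: "literal_fn j \<tau> (restr \<phi> \<rho>)" for \<rho> j \<tau>
  proof -
    have val: "restr \<phi> (subst_projection n \<rho> j \<sigma>) a = (\<sigma> = \<tau>)" for \<sigma> a
      using lit by (simp add: restr_subst_projection[OF over] literal_fn_def)
    have "subst_projection n \<rho> j \<tau> \<in> A" "subst_projection n \<rho> j (\<not> \<tau>) \<in> B"
      unfolding A_def B_def mem_Collect_eq val by blast+
    then have "\<rho> \<in> edges n \<tau> A B" unfolding edges_def by blast
    then show ?thesis by (cases \<tau>) simp_all
  qed
  then have "?P {\<pi>. is_literal (restr \<phi> \<pi>)} \<le> ?P (edges n True A B \<union> edges n False A B)"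
    by (intro measure_pmf.finite_measure_mono) (auto simp: is_literal_def)
  also have "\<dots> \<le> ?P (edges n True A B) + ?P (edges n False A B)"
    by (intro measure_Un_le) auto
  also have "\<dots> \<le> q * sqrt (fsize \<phi> * (?P A * ?P B)) + q * sqrt (fsize \<phi> * (?P A * ?P B))"
    unfolding q_def
    \<comment> \<open>Any assignment serves for \<open>a\<close>, since the restrictions in question
      are constant.\<close>
    by (intro add_mono khrapchenko_edges[OF p fix2 over, where a = undefined and c = True])
      (auto simp: A_def B_def)
  also have "\<dots> = q * sqrt (fsize \<phi>) * (2 * sqrt (?P A * ?P B))"
    by (simp add: real_sqrt_mult)
  also have "\<dots> \<le> q * sqrt (fsize \<phi>) * 1"
  proof (rule mult_left_mono)
    \<comment> \<open>Disjointness of \<open>A\<close> and \<open>B\<close> gives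
      \<open>sqrt (?P A * ?P B)\<close> at most 1/2, which cancels the factor 2 from the two kinds
      of edges.\<close>
    have "?P A + ?P B = ?P (A \<union> B)"
      by (intro measure_pmf.finite_measure_Union[symmetric]) (auto simp: A_def B_def)
    then have "?P A + ?P B \<le> 1" by simp
    then show "2 * sqrt (?P A * ?P B) \<le> 1"
      using arith_geo_mean_sqrt[of "?P A" "?P B"] by simp
  qed (use q in auto)
  finally show ?thesis by (simp add: q_def)
qed

section \<open>Conditioning on a subformula becoming a literal\<close>

definition fix_literal :: "nat \<Rightarrow> formula \<Rightarrow> bool \<Rightarrow> (nat \<Rightarrow> pvalue) \<Rightarrow> (nat \<Rightarrow> pvalue)" where
  "fix_literal n \<phi> b \<pi> =
     subst_projection n \<pi> (literal_var (restr \<phi> \<pi>)) (literal_sign (restr \<phi> \<pi>) = b)"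

text \<open>Conditioning is meaningful only if the literal event meets the support, hence the
  nonemptiness assumption in the lemmas below.\<close>

definition literal_cond :: "nat \<Rightarrow> formula \<Rightarrow> bool \<Rightarrow> (nat \<Rightarrow> pvalue) pmf \<Rightarrow> (nat \<Rightarrow> pvalue) pmf" where
  "literal_cond n \<phi> b p = map_pmf (fix_literal n \<phi> b) (cond_pmf p {\<pi>. is_literal (restr \<phi> \<pi>)})"

lemma prob_cond_pmf:
  assumes "set_pmf p \<inter> S \<noteq> {}"
  shows "measure_pmf.prob (cond_pmf p S) T = measure_pmf.prob p (S \<inter> T) / measure_pmf.prob p S"
proof -
  have "measure_pmf.prob p S \<noteq> 0" using assms by (auto simp: measure_pmf_zero_iff)
  then show ?thesis
    by (simp add: cond_pmf.rep_eq[OF assms] measure_pmf.emeasure_eq_measure)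
qed

lemma prob_literal_cond:
  assumes "set_pmf p \<inter> {\<pi>. is_literal (restr \<phi> \<pi>)} \<noteq> {}"
  shows "measure_pmf.prob (literal_cond n \<phi> b p) S =
    measure_pmf.prob p {\<pi>. is_literal (restr \<phi> \<pi>) \<and> fix_literal n \<phi> b \<pi> \<in> S}
      / measure_pmf.prob p {\<pi>. is_literal (restr \<phi> \<pi>)}"
  unfolding literal_cond_def measure_map_pmf prob_cond_pmf[OF assms]
  by (simp add: vimage_def Int_def)

lemma random_projection_literal_cond:
  assumes "random_projection n m p" "set_pmf p \<inter> {\<pi>. is_literal (restr \<phi> \<pi>)} \<noteq> {}"
  shows "random_projection n m (literal_cond n \<phi> b p)"
  using assms subst_projection_in_projections
  by (auto simp: random_projection_def literal_cond_def fix_literal_def)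

text \<open>Substituting a variable \<open>k\<close> other than the one of the literal \<open>\<phi>|\<rho>\<close> leaves this literal
  unchanged and commutes with fixing it, so the fixing inequality for \<open>p\<close> transfers.\<close>

lemma fixing2_literal_cond:
  assumes p: "random_projection n m p" and fix2: "fixing2 n m q\<^sub>0 q\<^sub>1 p"
    and over: "formula_over n \<phi>"
    and ne: "set_pmf p \<inter> {\<pi>. is_literal (restr \<phi> \<pi>)} \<noteq> {}"
  shows "fixing2 n m q\<^sub>0 q\<^sub>1 (literal_cond n \<phi> b p)"
  unfolding fixing2_def
proof (intro conjI ballI allI)
  fix \<pi> \<sigma> i assume i: "i \<in> {1..n}"
  let ?F = "fix_literal n \<phi> b"
  let ?lit = "\<lambda>\<rho>. is_literal (restr \<phi> \<rho>)"
  let ?P = "measure_pmf.prob p"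
  let ?q = "if \<sigma> then q\<^sub>1 else q\<^sub>0"
  let ?S = "{\<rho>. ?lit \<rho> \<and> ?F \<rho> \<in> {\<pi>}}"
  \<comment> \<open>Up to the normalising factor, \<open>?S\<close> carries the probability of
    \<open>\<pi>\<close> under the conditioned projection, and the substituted \<open>\<rho>\<close>
    lies in it again.\<close>
  have "\<exists>l. \<rho> i = Lit l \<and> subst_projection n \<rho> (lit_var l) \<sigma> \<in> ?S"
    if lit: "?lit \<rho>" and l: "?F \<rho> i = Lit l" "subst_projection n (?F \<rho>) (lit_var l) \<sigma> = \<pi>" for \<rho> l
  proof -
    obtain j \<tau> where j: "literal_fn j \<tau> (restr \<phi> \<rho>)" using lit by (auto simp: is_literal_def)
    have F: "?F \<rho> = subst_projection n \<rho> j (\<tau> = b)"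
      by (simp add: fix_literal_def literal_var_sign[OF j])
    have l': "\<rho> i = Lit l" "lit_var l \<noteq> j"
      using l(1) i by (auto simp: F subst_projection_def subst_pvalue_eq_Lit)
    let ?\<rho>' = "subst_projection n \<rho> (lit_var l) \<sigma>"
    have j': "literal_fn j \<tau> (restr \<phi> ?\<rho>')"
      unfolding literal_fn_def
    proof
      fix a
      show "restr \<phi> ?\<rho>' a = (a j = \<tau>)"
        using j l'(2) by (simp add: literal_fn_def restr_subst_projection[OF over])
    qed
    have "?F ?\<rho>' = subst_projection n (?F \<rho>) (lit_var l) \<sigma>"
      unfolding F using l'(2)
      by (simp add: fix_literal_def literal_var_sign[OF j'] subst_projection_commute)
    then show ?thesis using l l' j' by (auto simp: is_literal_def)
  qed
  then have "?P {\<rho>. ?lit \<rho> \<and> ?F \<rho> \<in> {\<rho>. \<exists>l. \<rho> i = Lit l \<and> subst_projection n \<rho> (lit_var l) \<sigma> = \<pi>}}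
      \<le> ?P {\<rho>. \<exists>l. \<rho> i = Lit l \<and> subst_projection n \<rho> (lit_var l) \<sigma> \<in> ?S}"
    by (intro measure_pmf.finite_measure_mono) (blast, simp)
  also have "\<dots> \<le> ?q * ?P ?S" by (rule fixing2_set[OF p fix2 i])
  finally show "measure_pmf.prob (literal_cond n \<phi> b p)
      {\<rho>. \<exists>l. \<rho> i = Lit l \<and> subst_projection n \<rho> (lit_var l) \<sigma> = \<pi>}
      \<le> ?q * pmf (literal_cond n \<phi> b p) \<pi>"
    unfolding measure_pmf_single[symmetric] prob_literal_cond[OF ne] times_divide_eq_right
    by (rule divide_right_mono) simp
qed (use fix2 in \<open>auto simp: fixing2_def\<close>)

lemma survives_iff_fix_literal:
  assumes "formula_over n \<psi>"
  shows "survives b (restr \<phi> \<pi>) (restr \<psi> \<pi>) \<longleftrightarrow>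
    is_literal (restr \<phi> \<pi>) \<and> \<not> is_const (restr \<psi> (fix_literal n \<phi> b \<pi>))"
  using assms
  by (simp add: survives_def fix_literal_def restr_subst_projection is_const_def)

text \<open>Survival factors into the probability that \<open>\<phi>\<close> becomes a literal and
  the conditional probability that \<open>\<psi>\<close> stays non-constant once that literal is
  neutral. The second factor concerns \<open>literal_cond\<close>, so \<open>v\<close> has to bound
  all fixing projections with the same parameters.\<close>

lemma prob_survives_le:
  assumes p: "random_projection n m p" and fix2: "fixing2 n m q\<^sub>0 q\<^sub>1 p"
    and over: "formula_over n \<phi>" "formula_over n \<psi>" and "0 \<le> v"
    and v: "\<And>p'. random_projection n m p' \<Longrightarrow> fixing2 n m q\<^sub>0 q\<^sub>1 p' \<Longrightarrow>
      measure_pmf.prob p' {\<pi>. \<not> is_const (restr \<psi> \<pi>)} \<le> v"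
  shows "measure_pmf.prob p {\<pi>. survives b (restr \<phi> \<pi>) (restr \<psi> \<pi>)}
    \<le> sqrt (q\<^sub>0 * q\<^sub>1) * sqrt (fsize \<phi>) * v"
proof (cases "set_pmf p \<inter> {\<pi>. is_literal (restr \<phi> \<pi>)} = {}")
  case True
  then have "measure_pmf.prob p {\<pi>. survives b (restr \<phi> \<pi>) (restr \<psi> \<pi>)} = 0"
    by (auto simp: measure_pmf_zero_iff survives_def)
  then show ?thesis using fix2 \<open>0 \<le> v\<close> by (simp add: fixing2_def)
next
  case False
  let ?lit = "{\<pi>. is_literal (restr \<phi> \<pi>)}"
  have pos: "0 < measure_pmf.prob p ?lit"
    using False by (auto simp: zero_less_measure_iff measure_pmf_zero_iff)
  have "measure_pmf.prob p {\<pi>. survives b (restr \<phi> \<pi>) (restr \<psi> \<pi>)}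
      = measure_pmf.prob p ?lit
        * measure_pmf.prob (literal_cond n \<phi> b p) {\<pi>. \<not> is_const (restr \<psi> \<pi>)}"
    using pos by (simp add: prob_literal_cond[OF False] survives_iff_fix_literal[OF over(2)])
  also have "\<dots> \<le> (sqrt (q\<^sub>0 * q\<^sub>1) * sqrt (fsize \<phi>)) * v"
    using fix2 prob_literal_le[OF p fix2 over(1)]
      v[OF random_projection_literal_cond[OF p False] fixing2_literal_cond[OF p fix2 over(1) False]]
    by (intro mult_mono) (auto simp: fixing2_def)
  finally show ?thesis .
qed

section \<open>The induction\<close>

lemma integrable_random_projection:
  fixes f :: "(nat \<Rightarrow> pvalue) \<Rightarrow> real"
  assumes "random_projection n m p"
  shows "integrable p f"
  using assms finite_projections
  by (intro integrable_measure_pmf_finite) (auto simp: random_projection_def intro: finite_subset)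

lemma expectation_mono_random_projection:
  fixes f g :: "(nat \<Rightarrow> pvalue) \<Rightarrow> real"
  assumes "random_projection n m p" "\<And>\<pi>. \<pi> \<in> projections n m \<Longrightarrow> f \<pi> \<le> g \<pi>"
  shows "measure_pmf.expectation p f \<le> measure_pmf.expectation p g"
  using assms integrable_random_projection[OF assms(1)]
  by (intro integral_mono_AE) (auto simp: AE_measure_pmf_iff random_projection_def)

lemma expectation_of_bool:
  "measure_pmf.expectation p (\<lambda>x. of_bool (P x)) = measure_pmf.prob p {x. P x}"
proof -
  have "(\<lambda>x. of_bool (P x) :: real) = indicator {x. P x}"
    by (auto simp: indicator_def)
  then show ?thesis by simp
qed

text \<open>A non-constant restriction is a literal or has truncated complexity at least 2, so its
  indicator is at most the sum of the two terms.\<close>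

lemma prob_not_const_le:
  assumes p: "random_projection n m p" and fix2: "fixing2 n m q\<^sub>0 q\<^sub>1 p" and over: "formula_over n \<phi>"
  shows "measure_pmf.prob p {\<pi>. \<not> is_const (restr \<phi> \<pi>)} \<le> sqrt (q\<^sub>0 * q\<^sub>1) * sqrt (fsize \<phi>)
    + measure_pmf.expectation p (\<lambda>\<pi>. real (complexity2 m (restr \<phi> \<pi>)))"
proof -
  have "measure_pmf.prob p {\<pi>. \<not> is_const (restr \<phi> \<pi>)}
      = measure_pmf.expectation p (\<lambda>\<pi>. of_bool (\<not> is_const (restr \<phi> \<pi>)))"
    by (rule expectation_of_bool[symmetric])
  also have "\<dots> \<le> measure_pmf.expectation p
      (\<lambda>\<pi>. of_bool (is_literal (restr \<phi> \<pi>)) + real (complexity2 m (restr \<phi> \<pi>)))"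
  proof (rule expectation_mono_random_projection[OF p])
    fix \<pi> assume "\<pi> \<in> projections n m"
    note c = restr_const_or_computable[OF this over]
    show "of_bool (\<not> is_const (restr \<phi> \<pi>))
        \<le> of_bool (is_literal (restr \<phi> \<pi>)) + real (complexity2 m (restr \<phi> \<pi>))"
      using formula_complexity_eq_0_iff[OF c] formula_complexity_1_literal[OF c]
      by (cases "formula_complexity m (restr \<phi> \<pi>) \<le> 1") (auto simp: complexity2_def le_Suc_eq)
  qed
  also have "\<dots> = measure_pmf.prob p {\<pi>. is_literal (restr \<phi> \<pi>)}
      + measure_pmf.expectation p (\<lambda>\<pi>. real (complexity2 m (restr \<phi> \<pi>)))"
    by (simp add: integrable_random_projection[OF p] expectation_of_bool)
  finally show ?thesis using prob_literal_le[OF p fix2 over] by simp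
qed

text \<open>The induction keeps \<open>p\<close> arbitrary because the survival bound uses the
  hypothesis for conditioned projections. Leaves match depth 0, as their truncated complexity
  vanishes.\<close>

lemma expectation_complexity2_le:
  assumes "random_projection n m p" "fixing2 n m q\<^sub>0 q\<^sub>1 p" "formula_over n \<phi>"
  shows "measure_pmf.expectation p (\<lambda>\<pi>. real (complexity2 m (restr \<phi> \<pi>)))
    \<le> (sqrt (q\<^sub>0 * q\<^sub>1))\<^sup>2 * (real (fdepth \<phi>))\<^sup>2 * real (fsize \<phi>)"
  using assms
proof (induction \<phi> arbitrary: p rule: formula_gate_induct)
  case (Leaf l)
  have "measure_pmf.expectation p (\<lambda>\<pi>. real (complexity2 m (restr (Leaf l) \<pi>)))
      \<le> measure_pmf.expectation p (\<lambda>\<pi>. 0)"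
  proof (rule expectation_mono_random_projection[OF Leaf.prems(1)])
    fix \<pi> assume "\<pi> \<in> projections n m"
    from restr_leaf[OF this Leaf.prems(3)] have "formula_complexity m (restr (Leaf l) \<pi>) \<le> 1"
      using formula_complexity_le[of m "Leaf _"] by (auto simp: formula_complexity_const)
    then show "real (complexity2 m (restr (Leaf l) \<pi>)) \<le> 0" by (simp add: complexity2_def)
  qed
  then show ?case by (simp del: feval.simps)
next
  case (gate b \<phi> \<psi>)
  define q where "q = sqrt (q\<^sub>0 * q\<^sub>1)"
  define D where "D = real (max (fdepth \<phi>) (fdepth \<psi>))"
  let ?L2 = "\<lambda>\<phi> \<pi>. complexity2 m (restr \<phi> \<pi>)"
  let ?E = "\<lambda>p f. measure_pmf.expectation p f :: real"
  let ?S = "\<lambda>\<phi> \<psi> \<pi>. survives b (restr \<phi> \<pi>) (restr \<psi> \<pi>)"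
  note p = gate.prems(1) and fix2 = gate.prems(2)
  have over: "formula_over n \<phi>" "formula_over n \<psi>" using gate.prems(3) by auto
  have q: "0 \<le> q" using fix2 by (simp add: q_def fixing2_def)
  have D: "0 \<le> D" by (simp add: D_def)
  have IH: "?E p' (\<lambda>\<pi>. ?L2 \<alpha> \<pi>) \<le> q\<^sup>2 * D\<^sup>2 * fsize \<alpha>"
    if "\<alpha> \<in> {\<phi>, \<psi>}" "random_projection n m p'" "fixing2 n m q\<^sub>0 q\<^sub>1 p'" for \<alpha> p'
  proof -
    have "?E p' (\<lambda>\<pi>. ?L2 \<alpha> \<pi>) \<le> q\<^sup>2 * (real (fdepth \<alpha>))\<^sup>2 * fsize \<alpha>"
      using gate.IH that over unfolding q_def by blast
    also have "\<dots> \<le> q\<^sup>2 * D\<^sup>2 * fsize \<alpha>"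
      using that(1) by (intro mult_right_mono mult_left_mono power_mono) (auto simp: D_def)
    finally show ?thesis .
  qed
  have survive: "measure_pmf.prob p {\<pi>. ?S \<alpha> \<beta> \<pi>} \<le> q\<^sup>2 * (1 + D) * sqrt (fsize \<alpha> * fsize \<beta>)"
    if "\<alpha> \<in> {\<phi>, \<psi>}" "\<beta> \<in> {\<phi>, \<psi>}" for \<alpha> \<beta>
  proof -
    have over': "formula_over n \<alpha>" "formula_over n \<beta>" using that over by auto
    let ?u = "q * sqrt (fsize \<beta>)"
    have u: "0 \<le> ?u" using q by simp
    have "measure_pmf.prob p' {\<pi>. \<not> is_const (restr \<beta> \<pi>)} \<le> ?u * (1 + D)"
      if p': "random_projection n m p'" "fixing2 n m q\<^sub>0 q\<^sub>1 p'" for p'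
    \<comment> \<open>If \<open>?u * D\<close> is at most 1, so is its square, which is then at most
      \<open>?u * D\<close>; otherwise the trivial bound 1 is below \<open>?u * D\<close>.\<close>
    proof (cases "?u * D \<le> 1")
      case True
      have "measure_pmf.prob p' {\<pi>. \<not> is_const (restr \<beta> \<pi>)} \<le> ?u + q\<^sup>2 * D\<^sup>2 * fsize \<beta>"
        using prob_not_const_le[OF p' over'(2)] IH[OF \<open>\<beta> \<in> {\<phi>, \<psi>}\<close> p'] by (simp add: q_def)
      also have "q\<^sup>2 * D\<^sup>2 * fsize \<beta> = (?u * D)\<^sup>2" by (simp add: power_mult_distrib)
      also have "\<dots> \<le> ?u * D"
        using True u D mult_left_le[of "?u * D" "?u * D"] by (simp add: power2_eq_square)
      finally show ?thesis by (simp add: algebra_simps)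
    next
      case False
      have "measure_pmf.prob p' {\<pi>. \<not> is_const (restr \<beta> \<pi>)} \<le> 1" by simp
      also have "\<dots> \<le> ?u + ?u * D" using False u by linarith
      finally show ?thesis by (simp add: algebra_simps)
    qed
    from prob_survives_le[OF p fix2 over' _ this]
    have "measure_pmf.prob p {\<pi>. ?S \<alpha> \<beta> \<pi>} \<le> q * sqrt (fsize \<alpha>) * (?u * (1 + D))"
      using u D by (simp add: q_def)
    then show ?thesis by (simp add: power2_eq_square real_sqrt_mult mult_ac)
  qed
  have "?E p (\<lambda>\<pi>. ?L2 (gate_formula b \<phi> \<psi>) \<pi>)
      \<le> ?E p (\<lambda>\<pi>. real (?L2 \<phi> \<pi>) + real (?L2 \<psi> \<pi>) + of_bool (?S \<phi> \<psi> \<pi>) + of_bool (?S \<psi> \<phi> \<pi>))"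
  proof (rule expectation_mono_random_projection[OF p])
    fix \<pi> assume \<pi>: "\<pi> \<in> projections n m"
    have "?L2 (gate_formula b \<phi> \<psi>) \<pi>
        \<le> ?L2 \<phi> \<pi> + ?L2 \<psi> \<pi> + of_bool (?S \<phi> \<psi> \<pi>) + of_bool (?S \<psi> \<phi> \<pi>)"
      unfolding restr_gate by (intro complexity2_gate_le restr_const_or_computable[OF \<pi>] over)
    then have "real (?L2 (gate_formula b \<phi> \<psi>) \<pi>)
        \<le> real (?L2 \<phi> \<pi> + ?L2 \<psi> \<pi> + of_bool (?S \<phi> \<psi> \<pi>) + of_bool (?S \<psi> \<phi> \<pi>))"
      by (rule of_nat_mono)
    then show "real (?L2 (gate_formula b \<phi> \<psi>) \<pi>)
        \<le> real (?L2 \<phi> \<pi>) + real (?L2 \<psi> \<pi>) + of_bool (?S \<phi> \<psi> \<pi>) + of_bool (?S \<psi> \<phi> \<pi>)"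
      by simp
  qed
  also have "\<dots> = ?E p (\<lambda>\<pi>. ?L2 \<phi> \<pi>) + ?E p (\<lambda>\<pi>. ?L2 \<psi> \<pi>)
      + measure_pmf.prob p {\<pi>. ?S \<phi> \<psi> \<pi>} + measure_pmf.prob p {\<pi>. ?S \<psi> \<phi> \<pi>}"
    by (simp add: integrable_random_projection[OF p] expectation_of_bool)
  also have "\<dots> \<le> q\<^sup>2 * D\<^sup>2 * fsize \<phi> + q\<^sup>2 * D\<^sup>2 * fsize \<psi>
      + q\<^sup>2 * (1 + D) * sqrt (fsize \<phi> * fsize \<psi>) + q\<^sup>2 * (1 + D) * sqrt (fsize \<psi> * fsize \<phi>)"
    by (intro add_mono IH survive p fix2) auto
  also have "\<dots> = q\<^sup>2 * (D\<^sup>2 * (fsize \<phi> + fsize \<psi>) + (1 + D) * (2 * sqrt (fsize \<phi> * fsize \<psi>)))"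
    by (simp add: algebra_simps)
  \<comment> \<open>The inequality of arithmetic and geometric means makes the extra cost linear in
    the size, so one level of depth raises the coefficient by \<open>1 + D\<close>, within the step
    from the square of \<open>D\<close> to that of \<open>D + 1\<close>.\<close>
  also have "\<dots> \<le> q\<^sup>2 * (D\<^sup>2 * (fsize \<phi> + fsize \<psi>) + (1 + D) * (fsize \<phi> + fsize \<psi>))"
    using arith_geo_mean_sqrt[of "fsize \<phi>" "fsize \<psi>"] D
    by (intro mult_left_mono add_left_mono) auto
  also have "\<dots> = q\<^sup>2 * (D\<^sup>2 + D + 1) * (fsize \<phi> + fsize \<psi>)"
    by (simp add: algebra_simps)
  also have "\<dots> \<le> q\<^sup>2 * (D + 1)\<^sup>2 * (fsize \<phi> + fsize \<psi>)"
    using D by (intro mult_right_mono mult_left_mono) (auto simp: power2_eq_square algebra_simps)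
  finally show ?case by (simp add: q_def D_def add.commute)
qed

theorem theorem3p6:
  shows "\<exists>C::real. C > 0 \<and>
    (\<forall>(n::nat) (m::nat) (s::nat) (d::nat) (q::real) (\<phi>::formula) (p::(nat \<Rightarrow> pvalue) pmf).
       formula_over n \<phi> \<and> fsize \<phi> = s \<and> fdepth \<phi> = d \<and>
       random_projection n m p \<and> fixing n m q p \<longrightarrow>
       measure_pmf.expectation p
         (\<lambda>\<pi>. real (formula_complexity m (apply_projection (feval \<phi>) \<pi>)))
       \<le> C * (q\<^sup>2 * (real d)\<^sup>2 * real s + q * sqrt (real s)))"
proof (intro exI[of _ 1] conjI allI impI)
  fix n m s d :: nat and q :: real and \<phi> and p :: "(nat \<Rightarrow> pvalue) pmf"
  assume "formula_over n \<phi> \<and> fsize \<phi> = s \<and> fdepth \<phi> = d \<and>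
    random_projection n m p \<and> fixing n m q p"
  then obtain q\<^sub>0 q\<^sub>1 where over: "formula_over n \<phi>" and s: "fsize \<phi> = s" and d: "fdepth \<phi> = d"
    and p: "random_projection n m p" and fix2: "fixing2 n m q\<^sub>0 q\<^sub>1 p" and q: "q = sqrt (q\<^sub>0 * q\<^sub>1)"
    by (auto simp: fixing_def)
  \<comment> \<open>Truncation discards only the value 1, attained by literals alone, so their
    probability makes up the difference.\<close>
  have "measure_pmf.expectation p (\<lambda>\<pi>. real (formula_complexity m (restr \<phi> \<pi>)))
      \<le> measure_pmf.expectation p
        (\<lambda>\<pi>. of_bool (is_literal (restr \<phi> \<pi>)) + real (complexity2 m (restr \<phi> \<pi>)))"
  proof (rule expectation_mono_random_projection[OF p])
    fix \<pi> assume "\<pi> \<in> projections n m"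
    note c = restr_const_or_computable[OF this over]
    show "real (formula_complexity m (restr \<phi> \<pi>))
        \<le> of_bool (is_literal (restr \<phi> \<pi>)) + real (complexity2 m (restr \<phi> \<pi>))"
      using formula_complexity_1_literal[OF c]
      by (cases "formula_complexity m (restr \<phi> \<pi>) \<le> 1") (auto simp: complexity2_def le_Suc_eq)
  qed
  also have "\<dots> = measure_pmf.prob p {\<pi>. is_literal (restr \<phi> \<pi>)}
      + measure_pmf.expectation p (\<lambda>\<pi>. real (complexity2 m (restr \<phi> \<pi>)))"
    by (simp add: integrable_random_projection[OF p] expectation_of_bool)
  also have "\<dots> \<le> q * sqrt s + q\<^sup>2 * (real d)\<^sup>2 * s"
    using prob_literal_le[OF p fix2 over] expectation_complexity2_le[OF p fix2 over]
    by (simp add: q s d)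
  finally show "measure_pmf.expectation p (\<lambda>\<pi>. real (formula_complexity m (restr \<phi> \<pi>)))
      \<le> 1 * (q\<^sup>2 * (real d)\<^sup>2 * real s + q * sqrt (real s))"
    by simp
qed simp

end
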